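(* Let $(\mathcal{P},\mathcal{H})$ be an intersection-closed hypothesis space with least hypotheses $H_P$, $P\in\mathcal{P}$. For each $P\in\mathcal{P}$ let $\Phi_P:[0,\infty]^{\mathcal{H}}\to[0,\infty]$ be a function that is: (i) local: $\Phi_P(\eta)=\Phi_P(\eta\,1_P)$, where $1_P(H):=\mathbf{1}\{P\in H\}$, $H\in\mathcal{H}$; (ii) positively homogeneous: $\Phi_P(c\,\eta)=c\,\Phi_P(\eta)$, $c\ge 0$; (iii) monotonic: $\eta\ge\eta'$ implies $\Phi_P(\eta)\ge\Phi_P(\eta')$, for every $\eta,\eta'\in[0,\infty]^{\mathcal{H}}$. Then, for every E-capacity $\varepsilon$ for $\mathcal{H}$, $$\Phi_P(\varepsilon)\le\varepsilon(H_P)\,\Phi_P(1_P),\quad\text{for every }P\in\mathcal{P}.$$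
   Context: $\mathcal{P}$ is a collection of probability measures on a measurable space. A hypothesis class $\mathcal{H}$ is a collection of subsets of $\mathcal{P}$ closed under arbitrary unions (including the empty union, so $\emptyset\in\mathcal{H}$); $(\mathcal{P},\mathcal{H})$ is then called a hypothesis space. It is intersection-closed if $\mathcal{H}$ is also closed under arbitrary intersections and $\mathcal{P}\in\mathcal{H}$. In that case every $P\in\mathcal{P}$ has a least hypothesis $H_P=\bigcap\{H\in\mathcal{H}:P\in H\}\in\mathcal{H}$, i.e. $P\in H_P$ and $H_P\subseteq H$ for every $H\in\mathcal{H}$ with $P\in H$. An E-capacity for $\mathcal{H}$ is a map $\varepsilon:\mathcal{H}\to[0,\infty]$ with $\varepsilon(\emptyset)=\infty$ and $\varepsilon(H')\le\varepsilon(H)$ whenever $H\subseteq H'$, $H,H'\in\mathcal{H}$. $[0,\infty]^{\mathcal{H}}$ is the set of functions $\eta:\mathcal{H}\to[0,\infty]$; products and inequalities of such functions are pointwise, with the convention $0\cdot\infty=\infty\cdot0=0$. *)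

theory Defs
  imports "HOL-Probability.Probability"
begin

definition hypothesis_space ::
    "'a measure \<Rightarrow> 'a measure set \<Rightarrow> 'a measure set set \<Rightarrow> bool" where
  "hypothesis_space M \<P> \<H> \<longleftrightarrow>
     (\<forall>P\<in>\<P>. prob_space P \<and> sets P = sets M) \<and>
     \<H> \<subseteq> Pow \<P> \<and>
     (\<forall>\<A>. \<A> \<subseteq> \<H> \<longrightarrow> \<Union>\<A> \<in> \<H>)"

(* Only nonempty intersections are considered: in HOL the empty intersection is UNIV.
   The intersection of the empty subfamily relative to \<P> is covered by \<P> \<in> \<H>. *)
definition intersection_closed :: "'b set \<Rightarrow> 'b set set \<Rightarrow> bool" where
  "intersection_closed \<P> \<H> \<longleftrightarrow>
     (\<forall>\<A>. \<A> \<subseteq> \<H> \<and> \<A> \<noteq> {} \<longrightarrow> \<Inter>\<A> \<in> \<H>) \<and> \<P> \<in> \<H>"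

definition least_hypothesis :: "'b set set \<Rightarrow> 'b \<Rightarrow> 'b set" where
  "least_hypothesis \<H> P = \<Inter>{H \<in> \<H>. P \<in> H}"

(* The set of functions from \<H> to [0,\<infinity>], as functions extensional outside \<H>.
   Multiplication on ennreal satisfies 0 * \<infinity> = \<infinity> * 0 = 0. *)
abbreviation ennreal_funs :: "'b set set \<Rightarrow> ('b set \<Rightarrow> ennreal) set" where
  "ennreal_funs \<H> \<equiv> \<H> \<rightarrow>\<^sub>E (UNIV :: ennreal set)"

definition e_capacity :: "'b set set \<Rightarrow> ('b set \<Rightarrow> ennreal) \<Rightarrow> bool" where
  "e_capacity \<H> \<epsilon> \<longleftrightarrow>
     \<epsilon> \<in> ennreal_funs \<H> \<and> \<epsilon> {} = \<infinity> \<and>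
     (\<forall>H\<in>\<H>. \<forall>H'\<in>\<H>. H \<subseteq> H' \<longrightarrow> \<epsilon> H' \<le> \<epsilon> H)"

definition one_at :: "'b set set \<Rightarrow> 'b \<Rightarrow> 'b set \<Rightarrow> ennreal" where
  "one_at \<H> P = (\<lambda>H\<in>\<H>. indicator H P)"

definition local_at ::
    "'b set set \<Rightarrow> 'b \<Rightarrow> (('b set \<Rightarrow> ennreal) \<Rightarrow> ennreal) \<Rightarrow> bool" where
  "local_at \<H> P \<phi> \<longleftrightarrow>
     (\<forall>\<eta>\<in>ennreal_funs \<H>. \<phi> \<eta> = \<phi> (\<lambda>H\<in>\<H>. \<eta> H * one_at \<H> P H))"

(* The scalar c ranges over all of [0,\<infinity>]. Homogeneity for finite c alone does not force
   \<phi> (\<infinity> * \<eta>) = \<infinity> * \<phi> \<eta>: the functional that is \<infinity> if \<eta> takes the value \<infinity> and 0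
   otherwise is homogeneous for every finite c. *)
definition positively_homogeneous ::
    "'b set set \<Rightarrow> (('b set \<Rightarrow> ennreal) \<Rightarrow> ennreal) \<Rightarrow> bool" where
  "positively_homogeneous \<H> \<phi> \<longleftrightarrow>
     (\<forall>c :: ennreal. \<forall>\<eta>\<in>ennreal_funs \<H>. \<phi> (\<lambda>H\<in>\<H>. c * \<eta> H) = c * \<phi> \<eta>)"

definition monotonic ::
    "'b set set \<Rightarrow> (('b set \<Rightarrow> ennreal) \<Rightarrow> ennreal) \<Rightarrow> bool" where
  "monotonic \<H> \<phi> \<longleftrightarrow>
     (\<forall>\<eta>\<in>ennreal_funs \<H>. \<forall>\<eta>'\<in>ennreal_funs \<H>.
        (\<forall>H\<in>\<H>. \<eta> H \<ge> \<eta>' H) \<longrightarrow> \<phi> \<eta> \<ge> \<phi> \<eta>')"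

end

theory Submission
  imports Defs
begin

text \<open>Among the hypotheses containing \<open>P\<close>, the least one carries the largest
  value of an E-capacity, because capacities are antitone
  (\<open>e_capacity_le_least_hypothesis\<close>). Locality lets \<open>\<Phi> P\<close> ignore all
  other hypotheses, so it sees only a function dominated by the constant
  \<open>\<epsilon> (least_hypothesis \<H> P)\<close> times \<open>one_at \<H> P\<close>.
  Monotonicity compares the two, and homogeneity pulls the constant out.\<close>

lemma least_hypothesis_mem:
  assumes "intersection_closed \<P> \<H>" and "P \<in> \<P>"
  shows "least_hypothesis \<H> P \<in> \<H>"
proof -
  \<comment> \<open>The family is nonempty because \<open>\<P>\<close> is itself a hypothesis
    containing \<open>P\<close>.\<close>
  have "{H \<in> \<H>. P \<in> H} \<subseteq> \<H>" and "{H \<in> \<H>. P \<in> H} \<noteq> {}"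
    using assms by (auto simp: intersection_closed_def)
  then show ?thesis
    using assms(1) by (simp add: intersection_closed_def least_hypothesis_def)
qed

lemma e_capacity_le_least_hypothesis:
  assumes "intersection_closed \<P> \<H>" and "P \<in> \<P>" and "e_capacity \<H> \<epsilon>"
    and "H \<in> \<H>" and "P \<in> H"
  shows "\<epsilon> H \<le> \<epsilon> (least_hypothesis \<H> P)"
proof -
  have "least_hypothesis \<H> P \<subseteq> H"
    using assms(4,5) by (auto simp: least_hypothesis_def)
  then show ?thesis
    using assms(3,4) least_hypothesis_mem[OF assms(1,2)] by (simp add: e_capacity_def)
qed

theorem theorem8:
  fixes M :: "'a measure"
    and \<P> :: "'a measure set"
    and \<H> :: "'a measure set set"
    and \<Phi> :: "'a measure \<Rightarrow> ('a measure set \<Rightarrow> ennreal) \<Rightarrow> ennreal"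
  assumes "hypothesis_space M \<P> \<H>"
    and "intersection_closed \<P> \<H>"
    and "\<And>P. P \<in> \<P> \<Longrightarrow> local_at \<H> P (\<Phi> P)"
    and "\<And>P. P \<in> \<P> \<Longrightarrow> positively_homogeneous \<H> (\<Phi> P)"
    and "\<And>P. P \<in> \<P> \<Longrightarrow> monotonic \<H> (\<Phi> P)"
  shows "\<forall>\<epsilon>. e_capacity \<H> \<epsilon> \<longrightarrow>
           (\<forall>P\<in>\<P>. \<Phi> P \<epsilon> \<le> \<epsilon> (least_hypothesis \<H> P) * \<Phi> P (one_at \<H> P))"
proof (intro allI impI ballI)
  fix \<epsilon> P
  assume \<epsilon>: "e_capacity \<H> \<epsilon>" and P: "P \<in> \<P>"
  let ?c = "\<epsilon> (least_hypothesis \<H> P)" and ?I = "one_at \<H> P"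
  \<comment> \<open>If \<open>P\<close> is not in \<open>H\<close>, both sides are 0, even where
    \<open>\<epsilon> H\<close> is infinite (as at the empty hypothesis), by the convention that 0
    times infinity is 0.\<close>
  have "\<epsilon> H * ?I H \<le> ?c * ?I H" if "H \<in> \<H>" for H
    using e_capacity_le_least_hypothesis[OF assms(2) P \<epsilon> that] that
    by (cases "P \<in> H") (auto simp: one_at_def)
  then have "\<Phi> P (\<lambda>H\<in>\<H>. \<epsilon> H * ?I H) \<le> \<Phi> P (\<lambda>H\<in>\<H>. ?c * ?I H)"
    using assms(5)[OF P] by (simp add: monotonic_def)
  moreover have "\<Phi> P \<epsilon> = \<Phi> P (\<lambda>H\<in>\<H>. \<epsilon> H * ?I H)"
    using \<epsilon> by (intro bspec[OF assms(3)[OF P, unfolded local_at_def]]) (simp add: e_capacity_def)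
  moreover have "?I \<in> ennreal_funs \<H>"
    by (simp add: one_at_def)
  \<comment> \<open>The scalar \<open>?c\<close> may be infinite; homogeneity is applied here over
    all of \<open>ennreal\<close>.\<close>
  then have "\<Phi> P (\<lambda>H\<in>\<H>. ?c * ?I H) = ?c * \<Phi> P ?I"
    using assms(4)[OF P] by (simp add: positively_homogeneous_def)
  ultimately show "\<Phi> P \<epsilon> \<le> ?c * \<Phi> P ?I"
    by metis
qed

end
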